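(* Let $n\ge2$, let $\theta_1,\dots,\theta_n>0$, and let $H:\mathbb{R}_+^n\to\mathbb{R}_+^n$ be the quadratic operator $H(x)=x'$ with $$x_k'=\frac{\theta_k x_k}{2}\Big(x_k+2\sum_{i\ne k}x_i\Big),\qquad k=1,\dots,n.$$ Then the sets $$\overline{M}_1=\Big\{x\in\mathbb{R}_+^n:\ x_k+2\sum_{i\ne k}x_i\le\frac{2}{\theta_k},\ \forall k=1,\dots,n\Big\},$$ $$\overline{M}_2=\Big\{x\in\mathbb{R}_+^n:\ x_k+2\sum_{i\ne k}x_i\ge\frac{2}{\theta_k},\ \forall k=1,\dots,n\Big\}$$ are invariant with respect to $H$. Moreover, for every initial point $\mathbf{x}^0\in\mathbb{R}_+^n$ that is not a fixed point of $H$, $$\lim_{m\to\infty}H^m(\mathbf{x}^0)=\begin{cases}(0,0,\dots,0), & \text{if } \mathbf{x}^0\in\overline{M}_1,\\ \infty, & \text{if }\mathbf{x}^0\in\overline{M}_2.\end{cases}$$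
   Context: $\mathbb{R}_+^n=\{x\in\mathbb{R}^n: x_i\ge 0 \text{ for all } i\}$. A set $M$ is invariant if $H(M)\subseteq M$. $H^m$ is the $m$-th iterate of $H$; the limit being $\infty$ means $\|H^m(\mathbf{x}^0)\|\to\infty$. *)

theory Defs
  imports "HOL-Analysis.Analysis"
begin

definition nonneg_orthant :: "(real ^ 'n) set" where
  "nonneg_orthant = {x. \<forall>i. 0 \<le> x $ i}"

text \<open>
  The parameters \<open>\<theta>\<close> are a family indexed by the coordinates. The operator is given by its formula on
  the whole space; it maps the nonnegative orthant to itself when all \<open>\<theta> k\<close> are nonnegative
  (lemma \<open>quad_op_nonneg_orthant\<close>).
\<close>

definition quad_op :: "('n::finite \<Rightarrow> real) \<Rightarrow> real ^ 'n \<Rightarrow> real ^ 'n" where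
  "quad_op \<theta> x = (\<chi> k. \<theta> k * x $ k / 2 * (x $ k + 2 * (\<Sum>i\<in>UNIV - {k}. x $ i)))"

definition M1_bar :: "('n::finite \<Rightarrow> real) \<Rightarrow> (real ^ 'n) set" where
  "M1_bar \<theta> = {x \<in> nonneg_orthant. \<forall>k. x $ k + 2 * (\<Sum>i\<in>UNIV - {k}. x $ i) \<le> 2 / \<theta> k}"

definition M2_bar :: "('n::finite \<Rightarrow> real) \<Rightarrow> (real ^ 'n) set" where
  "M2_bar \<theta> = {x \<in> nonneg_orthant. \<forall>k. x $ k + 2 * (\<Sum>i\<in>UNIV - {k}. x $ i) \<ge> 2 / \<theta> k}"

definition invariant_under :: "('a \<Rightarrow> 'a) \<Rightarrow> 'a set \<Rightarrow> bool" where
  "invariant_under H M \<longleftrightarrow> H ` M \<subseteq> M"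

lemma quad_op_nonneg_orthant:
  assumes "\<And>k. 0 \<le> \<theta> k"
  shows "quad_op \<theta> ` nonneg_orthant \<subseteq> nonneg_orthant"
  using assms
  by (auto simp: quad_op_def nonneg_orthant_def intro!: mult_nonneg_nonneg add_nonneg_nonneg sum_nonneg)

end

theory Submission
  imports Defs
begin

text \<open>
  On \<open>M1_bar\<close> orbits decrease coordinatewise, on \<open>M2_bar\<close> they increase, so an orbit either leaves
  every bounded set or converges to a fixed point \<open>p\<close>. If \<open>p $ k \<noteq> 0\<close>, the bracket of the \<open>k\<close>-th
  coordinate takes its critical value \<open>2 / \<theta> k\<close> at \<open>p\<close>; since it is strictly increasing in every
  coordinate, it attains this value only once along a monotone orbit together with its limit, which
  forces the orbit to start at \<open>p\<close>.
\<close>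

definition bracket :: "'n::finite \<Rightarrow> real ^ 'n \<Rightarrow> real" where
  "bracket k x = x $ k + 2 * (\<Sum>i\<in>UNIV - {k}. x $ i)"

text \<open>Isolates the growth factor of coordinate \<open>k\<close>: for positive
  \<open>\<theta> k\<close> it is at most 1 on \<open>M1_bar\<close> and at least 1 on
  \<open>M2_bar\<close>, with equality exactly when \<open>bracket k x\<close> is
  \<open>2 / \<theta> k\<close>.\<close>

lemma quad_op_nth: "quad_op \<theta> x $ k = x $ k * (\<theta> k / 2 * bracket k x)"
  by (simp add: quad_op_def bracket_def)

lemma mem_M1_bar_iff: "x \<in> M1_bar \<theta> \<longleftrightarrow> 0 \<le> x \<and> (\<forall>k. bracket k x \<le> 2 / \<theta> k)"
  by (simp add: M1_bar_def bracket_def nonneg_orthant_def less_eq_vec_def)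

lemma mem_M2_bar_iff: "x \<in> M2_bar \<theta> \<longleftrightarrow> 0 \<le> x \<and> (\<forall>k. 2 / \<theta> k \<le> bracket k x)"
  by (simp add: M2_bar_def bracket_def nonneg_orthant_def less_eq_vec_def)

lemma bracket_mono: "x \<le> y \<Longrightarrow> bracket k x \<le> bracket k y"
  by (auto simp: bracket_def less_eq_vec_def intro!: add_mono mult_left_mono sum_mono)

text \<open>The difference of the brackets is a combination of the nonnegative numbers
  \<open>y $ i - x $ i\<close> with coefficients 1 and 2, so it vanishes only if all of them
  do.\<close>

lemma bracket_eq_imp_eq:
  assumes "x \<le> y" "bracket k x = bracket k y"
  shows "x = y"
proof -
  have le: "x $ i \<le> y $ i" for i
    using assms(1) by (simp add: less_eq_vec_def)
  have "(y $ k - x $ k) + 2 * (\<Sum>i\<in>UNIV - {k}. y $ i - x $ i) = 0"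
    using assms(2) by (simp add: bracket_def sum_subtractf algebra_simps)
  moreover have "0 \<le> (\<Sum>i\<in>UNIV - {k}. y $ i - x $ i)"
    using le by (intro sum_nonneg) simp
  ultimately have "x $ k = y $ k" and s: "(\<Sum>i\<in>UNIV - {k}. y $ i - x $ i) = 0"
    using le[of k] by linarith+
  moreover from s have "x $ i = y $ i" if "i \<noteq> k" for i
    using le that by (subst (asm) sum_nonneg_eq_0_iff) auto
  ultimately show ?thesis
    by (metis vec_eq_iff)
qed

lemma quad_op_nonneg:
  assumes "\<And>k. 0 < \<theta> k" "0 \<le> x"
  shows "0 \<le> quad_op \<theta> x"
proof -
  have "x \<in> nonneg_orthant"
    using assms(2) by (simp add: nonneg_orthant_def less_eq_vec_def)
  then have "quad_op \<theta> x \<in> nonneg_orthant"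
    using quad_op_nonneg_orthant[of \<theta>] assms(1) by (auto simp: less_imp_le)
  then show ?thesis
    by (simp add: nonneg_orthant_def less_eq_vec_def)
qed

lemma quad_op_le:
  assumes "\<And>k. 0 < \<theta> k" "x \<in> M1_bar \<theta>"
  shows "quad_op \<theta> x \<le> x"
  unfolding less_eq_vec_def
proof
  fix k
  have "bracket k x \<le> 2 / \<theta> k" and "0 \<le> x $ k"
    using assms(2) by (auto simp: mem_M1_bar_iff less_eq_vec_def)
  moreover from this(1) have "\<theta> k / 2 * bracket k x \<le> 1"
    using assms(1)[of k] by (simp add: field_simps)
  ultimately show "quad_op \<theta> x $ k \<le> x $ k"
    unfolding quad_op_nth by (intro mult_left_le)
qed

lemma le_quad_op:
  assumes "\<And>k. 0 < \<theta> k" "x \<in> M2_bar \<theta>"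
  shows "x \<le> quad_op \<theta> x"
  unfolding less_eq_vec_def
proof
  fix k
  have "2 / \<theta> k \<le> bracket k x" and "0 \<le> x $ k"
    using assms(2) by (auto simp: mem_M2_bar_iff less_eq_vec_def)
  moreover from this(1) have "1 \<le> \<theta> k / 2 * bracket k x"
    using assms(1)[of k] by (simp add: field_simps)
  ultimately show "x $ k \<le> quad_op \<theta> x $ k"
    unfolding quad_op_nth by (metis mult_left_mono mult.right_neutral)
qed

text \<open>One step moves the point down, and \<open>bracket\<close> is monotone, so the upper
  bounds on the brackets survive.\<close>

lemma quad_op_M1_bar:
  assumes "\<And>k. 0 < \<theta> k" "x \<in> M1_bar \<theta>"
  shows "quad_op \<theta> x \<in> M1_bar \<theta>"
  using assms quad_op_nonneg[of \<theta> x] bracket_mono[OF quad_op_le[OF assms]]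
  by (auto simp: mem_M1_bar_iff intro: order_trans)

lemma quad_op_M2_bar:
  assumes "\<And>k. 0 < \<theta> k" "x \<in> M2_bar \<theta>"
  shows "quad_op \<theta> x \<in> M2_bar \<theta>"
  using assms quad_op_nonneg[of \<theta> x] bracket_mono[OF le_quad_op[OF assms]]
  by (auto simp: mem_M2_bar_iff intro: order_trans)

lemma bracket_fixed_point:
  assumes "\<theta> k > 0" "quad_op \<theta> p = p" "p $ k \<noteq> 0"
  shows "bracket k p = 2 / \<theta> k"
proof -
  have "p $ k = p $ k * (\<theta> k / 2 * bracket k p)"
    using quad_op_nth[of \<theta> p k] assms(2) by simp
  then show ?thesis
    using assms by (simp add: field_simps)
qed

text \<open>A nonzero coordinate \<open>k\<close> of \<open>p\<close> gives \<open>2 / \<theta> k =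
  bracket k p \<le> bracket k x \<le> 2 / \<theta> k\<close>, so equality holds throughout. The
  origin has to be excluded because it is a fixed point below all of \<open>M1_bar\<close>.\<close>

lemma fixed_point_below_M1_bar:
  assumes "\<And>k. 0 < \<theta> k" "x \<in> M1_bar \<theta>" "p \<le> x" "quad_op \<theta> p = p" "p \<noteq> 0"
  shows "p = x"
proof -
  obtain k where "p $ k \<noteq> 0"
    using assms(5) by (auto simp: vec_eq_iff)
  then have "bracket k p = 2 / \<theta> k"
    using assms by (intro bracket_fixed_point)
  moreover have "bracket k x \<le> 2 / \<theta> k"
    using assms(2) by (simp add: mem_M1_bar_iff)
  ultimately have "bracket k p = bracket k x"
    using bracket_mono[OF assms(3), of k] by simp
  with assms(3) show ?thesis
    by (rule bracket_eq_imp_eq)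
qed

lemma fixed_point_above_M2_bar:
  assumes "\<And>k. 0 < \<theta> k" "x \<in> M2_bar \<theta>" "x \<le> p" "quad_op \<theta> p = p"
  shows "x = p"
proof (cases "p = 0")
  \<comment> \<open>Here \<open>0 \<le> x \<le> p = 0\<close>, so antisymmetry gives the
    claim.\<close>
  case True
  then show ?thesis
    using assms(2,3) by (auto simp: mem_M2_bar_iff)
next
  case False
  then obtain k where "p $ k \<noteq> 0"
    by (auto simp: vec_eq_iff)
  then have "bracket k p = 2 / \<theta> k"
    using assms by (intro bracket_fixed_point)
  moreover have "2 / \<theta> k \<le> bracket k x"
    using assms(2) by (simp add: mem_M2_bar_iff)
  ultimately have "bracket k x = bracket k p"
    using bracket_mono[OF assms(3), of k] by simp
  with assms(3) show ?thesis
    by (rule bracket_eq_imp_eq)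
qed

text \<open>The shifted orbit tends to \<open>p\<close>, and also to
  \<open>quad_op \<theta> p\<close> because the operator is polynomial in the coordinates, hence
  continuous.\<close>

lemma quad_op_orbit_limit_fixed:
  assumes "(\<lambda>m. (quad_op \<theta> ^^ m) x) \<longlonglongrightarrow> p"
  shows "quad_op \<theta> p = p"
proof (rule LIMSEQ_unique)
  show "(\<lambda>m. (quad_op \<theta> ^^ Suc m) x) \<longlonglongrightarrow> p"
    using assms by (rule LIMSEQ_Suc)
  show "(\<lambda>m. (quad_op \<theta> ^^ Suc m) x) \<longlonglongrightarrow> quad_op \<theta> p"
    unfolding funpow.simps comp_apply quad_op_def
    by (rule tendsto_vec_lambda) (intro tendsto_intros assms[unfolded quad_op_def]; simp)
qed

lemma convergent_vecI:
  fixes X :: "nat \<Rightarrow> real ^ 'n"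
  assumes "\<And>k. convergent (\<lambda>m. X m $ k)"
  shows "convergent X"
proof -
  have "X \<longlonglongrightarrow> (\<chi> k. lim (\<lambda>m. X m $ k))"
    using assms by (intro vec_tendstoI) (simp add: convergent_LIMSEQ_iff)
  then show ?thesis
    by (rule convergentI)
qed

lemma quad_op_orbit_M1_bar:
  assumes \<theta>: "\<And>k. 0 < \<theta> k" and x: "x \<in> M1_bar \<theta>" "quad_op \<theta> x \<noteq> x"
  shows "(\<lambda>m. (quad_op \<theta> ^^ m) x) \<longlonglongrightarrow> 0"
proof -
  let ?X = "\<lambda>m. (quad_op \<theta> ^^ m) x"
  have X: "?X m \<in> M1_bar \<theta>" for m
    by (induction m) (auto simp: x quad_op_M1_bar \<theta>)
  have dec: "decseq (\<lambda>m. ?X m $ k)" for k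
    using quad_op_le[OF \<theta> X] by (intro decseq_SucI) (simp add: less_eq_vec_def)
  have nonneg: "0 \<le> ?X m $ k" for m k
    using X[of m] by (simp add: mem_M1_bar_iff less_eq_vec_def)
  have "convergent ?X"
    using decseq_convergent[OF dec] nonneg by (metis convergentI convergent_vecI)
  then obtain p where p: "?X \<longlonglongrightarrow> p"
    by (auto simp: convergent_def)
  \<comment> \<open>A decreasing sequence stays above its limit; index 0 compares the limit with the
    starting point.\<close>
  have "p $ k \<le> ?X 0 $ k" for k
    using dec tendsto_vec_nth[OF p] by (rule decseq_ge)
  then have "p \<le> x"
    by (simp add: less_eq_vec_def)
  \<comment> \<open>A nonzero limit would equal \<open>x\<close>, which is not fixed.\<close>
  with fixed_point_below_M1_bar[OF \<theta> x(1)] x(2) quad_op_orbit_limit_fixed[OF p] have "p = 0"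
    by blast
  with p show ?thesis by simp
qed

lemma quad_op_orbit_M2_bar:
  assumes \<theta>: "\<And>k. 0 < \<theta> k" and x: "x \<in> M2_bar \<theta>" "quad_op \<theta> x \<noteq> x"
  shows "filterlim (\<lambda>m. norm ((quad_op \<theta> ^^ m) x)) at_top sequentially"
proof -
  let ?X = "\<lambda>m. (quad_op \<theta> ^^ m) x"
  have X: "?X m \<in> M2_bar \<theta>" for m
    by (induction m) (auto simp: x quad_op_M2_bar \<theta>)
  have inc: "incseq (\<lambda>m. ?X m $ k)" for k
    using le_quad_op[OF \<theta> X] by (intro incseq_SucI) (simp add: less_eq_vec_def)
  \<comment> \<open>If every coordinate were bounded, the increasing orbit would converge to a fixed
    point above \<open>x\<close>, hence to \<open>x\<close> itself, which is not fixed.\<close>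
  have "\<exists>k. \<forall>B. \<exists>m. B < ?X m $ k"
  proof (rule ccontr)
    assume "\<not> ?thesis"
    then have "\<exists>B. \<forall>m. ?X m $ k \<le> B" for k
      by (meson not_less)
    then have "convergent ?X"
      using incseq_convergent[OF inc] by (metis convergentI convergent_vecI)
    then obtain p where p: "?X \<longlonglongrightarrow> p"
      by (auto simp: convergent_def)
    have "?X 0 $ k \<le> p $ k" for k
      using inc tendsto_vec_nth[OF p] by (rule incseq_le)
    then have "x \<le> p"
      by (simp add: less_eq_vec_def)
    with fixed_point_above_M2_bar[OF \<theta> x(1)] x(2) quad_op_orbit_limit_fixed[OF p] show False
      by blast
  qed
  then obtain k where k: "\<And>B. \<exists>m. B < ?X m $ k"
    by blast
  \<comment> \<open>Monotonicity turns unboundedness of this coordinate into divergence of the whole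
    sequence, and the norm dominates the coordinate.\<close>
  have "filterlim (\<lambda>m. ?X m $ k) at_top sequentially"
    unfolding filterlim_at_top eventually_sequentially
    using k incseqD[OF inc] by (meson less_imp_le order_trans)
  moreover have "?X m $ k \<le> norm (?X m)" for m
    using component_le_norm_cart[of "?X m" k] by linarith
  ultimately show ?thesis
    by (auto elim: filterlim_at_top_mono)
qed

theorem proposition11:
  fixes \<theta> :: "'n::finite \<Rightarrow> real"
  assumes "CARD('n) \<ge> 2"
    and "\<And>k. \<theta> k > 0"
  shows "invariant_under (quad_op \<theta>) (M1_bar \<theta>)
    \<and> invariant_under (quad_op \<theta>) (M2_bar \<theta>)
    \<and> (\<forall>x0 \<in> nonneg_orthant. quad_op \<theta> x0 \<noteq> x0 \<longrightarrow>
        (x0 \<in> M1_bar \<theta> \<longrightarrow> (\<lambda>m. (quad_op \<theta> ^^ m) x0) \<longlonglongrightarrow> 0)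
      \<and> (x0 \<in> M2_bar \<theta> \<longrightarrow> filterlim (\<lambda>m. norm ((quad_op \<theta> ^^ m) x0)) at_top sequentially))"
  using quad_op_M1_bar[OF assms(2)] quad_op_M2_bar[OF assms(2)]
    quad_op_orbit_M1_bar[OF assms(2)] quad_op_orbit_M2_bar[OF assms(2)]
  by (auto simp: invariant_under_def)

end
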